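(* Let $(X,\mu,\mathcal{E},\mathcal{F})$ be a Dirichlet space whose heat kernel satisfies $p_t(x,y)\le C_ht^{-\beta}$ for $\mu\times\mu$-a.e. $(x,y)\in X\times X$ and every $t>0$, for some constants $C_h>0$ and $\beta>0$. Assume that condition $(\mathrm{PPI}_p)$ is satisfied for some $p\ge1$ such that $p\alpha_p>\beta$. Then there exists a constant $C_p>0$ such that for every $f\in W^{1,p}(\mathcal{E})$ (or $f\in BV(\mathcal{E})$ if $p=1$) and every $s\ge1$, $$\|f\|_{L^\infty(X,\mu)}\le C_p\,\mathbf{Var}_{p,\mathcal{E}}(f)^{\theta}\,\|f\|_{L^s(X,\mu)}^{1-\theta},$$ where $\theta\in(0,1)$ is given by $\theta=\frac{p\beta}{p\beta+s(p\alpha_p-\beta)}$.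
   Context: $X$ is a good measurable space (like a Polish or Radon space) with a $\sigma$-finite measure $\mu$ supported on $X$, and $(\mathcal{E},\mathcal{F})$, $\mathcal{F}=\mathrm{dom}\,\mathcal{E}$, is a Dirichlet form on $L^2(X,\mu)$. Its heat semigroup $\{P_t\}_{t\ge0}$, extended to all $L^p(X,\mu)$, $1\le p\le\infty$, is assumed conservative ($P_t1=1$), and it admits a measurable heat kernel $p_t(x,y)$. For $p\ge1$, $\alpha\ge0$ (with $P_t(|f-f(y)|^p)(y)$ meaning $P_t$ applied to $x\mapsto|f(x)-f(y)|^p$, evaluated at $y$), $$\mathbf{B}^{p,\alpha}(X)=\Big\{f\in L^p(X,\mu):\limsup_{t\to0^+}t^{-\alpha}\Big(\int_XP_t(|f-f(y)|^p)(y)\,d\mu(y)\Big)^{1/p}<\infty\Big\}.$$ Set $\alpha_p=\sup\{\alpha>0:\mathbf{B}^{p,\alpha}(X)\text{ contains non a.e. constant functions}\}$ (understood to be a finite positive number), $W^{1,p}(\mathcal{E})=\mathbf{B}^{p,\alpha_p}(X)$ for $p>1$, $BV(\mathcal{E})=\mathbf{B}^{1,\alpha_1}(X)$, and for $f$ in these classes $$\mathbf{Var}_{p,\mathcal{E}}(f)=\liminf_{t\to0^+}t^{-\alpha_p}\Big(\int_XP_t(|f-f(y)|^p)(y)\,d\mu(y)\Big)^{1/p}.$$ Condition $(\mathrm{PPI}_p)$: there is a constant $C>0$ such that $\|P_tf-f\|_{L^p(X,\mu)}\le C\,t^{\alpha_p}\,\mathbf{Var}_{p,\mathcal{E}}(f)$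 for every $t\ge0$ and $f\in W^{1,p}(\mathcal{E})$ (or $f\in BV(\mathcal{E})$ if $p=1$). *)

theory Defs
  imports "HOL-Probability.Essential_Supremum"
begin

section \<open>Lebesgue spaces\<close>

text \<open>
  Elements of \<open>L\<^sup>q\<close> are represented by measurable functions; all notions below respect
  equality almost everywhere.
\<close>

text \<open>Powers of extended nonnegative numbers; used only with exponents \<open>a > 0\<close>.\<close>

definition epowr :: "ennreal \<Rightarrow> real \<Rightarrow> ennreal"  (infixr "epowr" 80)
  where "x epowr a = (if x = \<infinity> then \<infinity> else ennreal (enn2real x powr a))"

definition Lnorm :: "'a measure \<Rightarrow> ennreal \<Rightarrow> ('a \<Rightarrow> real) \<Rightarrow> ennreal"
  where "Lnorm M q f =
    (if q = \<infinity> then esssup M (\<lambda>x. ennreal \<bar>f x\<bar>)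
     else (\<integral>\<^sup>+x. ennreal (\<bar>f x\<bar> powr enn2real q) \<partial>M) epowr (1 / enn2real q))"

definition Lspace :: "'a measure \<Rightarrow> ennreal \<Rightarrow> ('a \<Rightarrow> real) set"
  where "Lspace M q = {f \<in> borel_measurable M. Lnorm M q f < \<infinity>}"


section \<open>Dirichlet forms and their heat semigroups\<close>

text \<open>
  A densely defined, nonnegative, symmetric, bilinear form on \<open>L\<^sup>2\<close> which is closed (the domain is
  complete for the norm \<open>(E f f + \<parallel>f\<parallel>\<^sup>2)\<^sup>1\<^sup>/\<^sup>2\<close>) and Markovian (the unit contraction operates).
  The third and fourth clauses make domain and form well defined on classes modulo null sets.
\<close>

definition dirichlet_form ::
    "'a measure \<Rightarrow> (('a \<Rightarrow> real) \<Rightarrow> ('a \<Rightarrow> real) \<Rightarrow> real) \<Rightarrow> ('a \<Rightarrow> real) set \<Rightarrow> bool"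
  where "dirichlet_form M E F \<longleftrightarrow>
    F \<subseteq> Lspace M 2
    \<and> (\<forall>f\<in>Lspace M 2. \<forall>e>0. \<exists>g\<in>F. Lnorm M 2 (\<lambda>x. f x - g x) < ennreal e)
    \<and> (\<forall>f\<in>F. \<forall>g\<in>borel_measurable M. (AE x in M. f x = g x) \<longrightarrow> g \<in> F)
    \<and> (\<forall>f\<in>F. \<forall>g\<in>F. (AE x in M. f x = g x) \<longrightarrow> (\<forall>h\<in>F. E f h = E g h))
    \<and> (\<forall>f\<in>F. \<forall>g\<in>F. \<forall>a b. (\<lambda>x. a * f x + b * g x) \<in> F
          \<and> (\<forall>h\<in>F. E (\<lambda>x. a * f x + b * g x) h = a * E f h + b * E g h))
    \<and> (\<forall>f\<in>F. \<forall>g\<in>F. E f g = E g f)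
    \<and> (\<forall>f\<in>F. 0 \<le> E f f)
    \<and> (\<forall>u :: nat \<Rightarrow> 'a \<Rightarrow> real.
          (\<forall>n. u n \<in> F)
          \<and> (\<forall>e>0. \<exists>N. \<forall>m\<ge>N. \<forall>n\<ge>N.
                E (\<lambda>x. u m x - u n x) (\<lambda>x. u m x - u n x)
                  + (\<integral>x. (u m x - u n x)\<^sup>2 \<partial>M) < e)
          \<longrightarrow> (\<exists>f\<in>F. (\<lambda>n. E (\<lambda>x. u n x - f x) (\<lambda>x. u n x - f x)
                  + (\<integral>x. (u n x - f x)\<^sup>2 \<partial>M)) \<longlonglongrightarrow> 0))
    \<and> (\<forall>f\<in>F. (\<lambda>x. min (max (f x) 0) 1) \<in> F
          \<and> E (\<lambda>x. min (max (f x) 0) 1) (\<lambda>x. min (max (f x) 0) 1) \<le> E f f)"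

text \<open>
  The generator \<open>L\<close> of a form, \<open>E f g = - \<langle>L f, g\<rangle>\<close>, and the infinitesimal generator on \<open>L\<^sup>2\<close> of a
  family of operators, both as relations between \<open>f\<close> and \<open>h = L f\<close>.
\<close>

definition form_generator ::
    "'a measure \<Rightarrow> (('a \<Rightarrow> real) \<Rightarrow> ('a \<Rightarrow> real) \<Rightarrow> real) \<Rightarrow> ('a \<Rightarrow> real) set
      \<Rightarrow> ('a \<Rightarrow> real) \<Rightarrow> ('a \<Rightarrow> real) \<Rightarrow> bool"
  where "form_generator M E F f h \<longleftrightarrow>
    f \<in> F \<and> h \<in> Lspace M 2 \<and> (\<forall>g\<in>F. E f g = - (\<integral>x. h x * g x \<partial>M))"

definition infinitesimal_generator ::
    "'a measure \<Rightarrow> (real \<Rightarrow> ('a \<Rightarrow> real) \<Rightarrow> ('a \<Rightarrow> real)) \<Rightarrow> ('a \<Rightarrow> real) \<Rightarrow> ('a \<Rightarrow> real) \<Rightarrow> bool"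
  where "infinitesimal_generator M P f h \<longleftrightarrow>
    f \<in> Lspace M 2 \<and> h \<in> Lspace M 2
    \<and> ((\<lambda>t. Lnorm M 2 (\<lambda>x. (P t f x - f x) / t - h x)) \<longlongrightarrow> 0) (at_right 0)"

text \<open>
  The heat semigroup of \<open>(E, F)\<close>: the strongly continuous contraction semigroup on \<open>L\<^sup>2\<close> whose
  infinitesimal generator is the generator of the form, together with its extension to every
  \<open>L\<^sup>q\<close>, \<open>1 \<le> q \<le> \<infinity>\<close>. For \<open>q < \<infinity>\<close> the extension is the one by density (linear contractions
  agreeing with the \<open>L\<^sup>2\<close> operators, as \<open>P t\<close> is a single operator on all these spaces); on
  \<open>L\<^sup>\<infinity>\<close> it is the adjoint of the operator on \<open>L\<^sup>1\<close>, which is the last clause.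
\<close>

definition heat_semigroup ::
    "'a measure \<Rightarrow> (('a \<Rightarrow> real) \<Rightarrow> ('a \<Rightarrow> real) \<Rightarrow> real) \<Rightarrow> ('a \<Rightarrow> real) set
      \<Rightarrow> (real \<Rightarrow> ('a \<Rightarrow> real) \<Rightarrow> ('a \<Rightarrow> real)) \<Rightarrow> bool"
  where "heat_semigroup M E F P \<longleftrightarrow>
    (\<forall>q\<ge>1. \<forall>t\<ge>0. \<forall>f\<in>Lspace M q.
        P t f \<in> Lspace M q \<and> Lnorm M q (P t f) \<le> Lnorm M q f)
    \<and> (\<forall>q\<ge>1. \<forall>t\<ge>0. \<forall>f\<in>Lspace M q. \<forall>g\<in>Lspace M q. \<forall>a b.
        AE x in M. P t (\<lambda>y. a * f y + b * g y) x = a * P t f x + b * P t g x)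
    \<and> (\<forall>q\<ge>1. \<forall>f\<in>Lspace M q. AE x in M. P 0 f x = f x)
    \<and> (\<forall>q\<ge>1. \<forall>s\<ge>0. \<forall>t\<ge>0. \<forall>f\<in>Lspace M q. AE x in M. P (s + t) f x = P s (P t f) x)
    \<and> (\<forall>f\<in>Lspace M 2. ((\<lambda>t. Lnorm M 2 (\<lambda>x. P t f x - f x)) \<longlongrightarrow> 0) (at_right 0))
    \<and> (\<forall>f h. infinitesimal_generator M P f h \<longleftrightarrow> form_generator M E F f h)
    \<and> (\<forall>t\<ge>0. \<forall>f\<in>Lspace M \<infinity>. \<forall>g\<in>Lspace M 1.
        (\<integral>x. P t f x * g x \<partial>M) = (\<integral>x. f x * P t g x \<partial>M))"

definition conservative :: "'a measure \<Rightarrow> (real \<Rightarrow> ('a \<Rightarrow> real) \<Rightarrow> ('a \<Rightarrow> real)) \<Rightarrow> bool"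
  where "conservative M P \<longleftrightarrow> (\<forall>t\<ge>0. AE x in M. P t (\<lambda>_. 1) x = 1)"

text \<open>
  Nonnegativity everywhere is the usual choice of version: \<open>P t\<close> preserves positivity, so a kernel
  is nonnegative almost everywhere anyway.
\<close>

definition heat_kernel ::
    "'a measure \<Rightarrow> (real \<Rightarrow> ('a \<Rightarrow> real) \<Rightarrow> ('a \<Rightarrow> real)) \<Rightarrow> (real \<Rightarrow> 'a \<Rightarrow> 'a \<Rightarrow> real) \<Rightarrow> bool"
  where "heat_kernel M P k \<longleftrightarrow>
    (\<forall>t>0. (\<lambda>(x, y). k t x y) \<in> borel_measurable (M \<Otimes>\<^sub>M M)
      \<and> (\<forall>x\<in>space M. \<forall>y\<in>space M. 0 \<le> k t x y)
      \<and> (\<forall>q\<ge>1. \<forall>f\<in>Lspace M q. AE x in M.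
            integrable M (\<lambda>y. k t x y * f y) \<and> P t f x = (\<integral>y. k t x y * f y \<partial>M)))"


section \<open>Heat semigroup based Besov classes\<close>

text \<open>
  The quantity \<open>(\<integral> P\<^sub>t(|f - f(y)|\<^sup>p)(y) d\<mu>(y))\<^sup>1\<^sup>/\<^sup>p\<close>. As the function to which \<open>P t\<close> is applied depends
  on the point \<open>y\<close> of evaluation, \<open>P t\<close> is written through its kernel. The value may be infinite.
\<close>

definition heat_energy ::
    "'a measure \<Rightarrow> (real \<Rightarrow> 'a \<Rightarrow> 'a \<Rightarrow> real) \<Rightarrow> real \<Rightarrow> ('a \<Rightarrow> real) \<Rightarrow> real \<Rightarrow> ennreal"
  where "heat_energy M k p f t =
    (\<integral>\<^sup>+y. (\<integral>\<^sup>+x. ennreal (k t y x * \<bar>f x - f y\<bar> powr p) \<partial>M) \<partial>M) epowr (1 / p)"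

definition besov ::
    "'a measure \<Rightarrow> (real \<Rightarrow> 'a \<Rightarrow> 'a \<Rightarrow> real) \<Rightarrow> real \<Rightarrow> real \<Rightarrow> ('a \<Rightarrow> real) set"
  where "besov M k p \<alpha> =
    {f \<in> Lspace M (ennreal p).
      Limsup (at_right 0) (\<lambda>t. ennreal (t powr (- \<alpha>)) * heat_energy M k p f t) < \<infinity>}"

definition nonconstant_exponents ::
    "'a measure \<Rightarrow> (real \<Rightarrow> 'a \<Rightarrow> 'a \<Rightarrow> real) \<Rightarrow> real \<Rightarrow> real set"
  where "nonconstant_exponents M k p =
    {\<alpha>. 0 < \<alpha> \<and> (\<exists>f\<in>besov M k p \<alpha>. \<not> (\<exists>c. AE x in M. f x = c))}"

text \<open>Meaningful when the set of exponents is nonempty and bounded above.\<close>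

definition critical_exponent ::
    "'a measure \<Rightarrow> (real \<Rightarrow> 'a \<Rightarrow> 'a \<Rightarrow> real) \<Rightarrow> real \<Rightarrow> real"
  where "critical_exponent M k p = Sup (nonconstant_exponents M k p)"

text \<open>\<open>W\<^sup>1\<^sup>,\<^sup>p(E)\<close> for \<open>p > 1\<close> and \<open>BV(E)\<close> for \<open>p = 1\<close>.\<close>

definition sobolev_bv ::
    "'a measure \<Rightarrow> (real \<Rightarrow> 'a \<Rightarrow> 'a \<Rightarrow> real) \<Rightarrow> real \<Rightarrow> ('a \<Rightarrow> real) set"
  where "sobolev_bv M k p = besov M k p (critical_exponent M k p)"

definition Var ::
    "'a measure \<Rightarrow> (real \<Rightarrow> 'a \<Rightarrow> 'a \<Rightarrow> real) \<Rightarrow> real \<Rightarrow> ('a \<Rightarrow> real) \<Rightarrow> ennreal"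
  where "Var M k p f =
    Liminf (at_right 0)
      (\<lambda>t. ennreal (t powr (- critical_exponent M k p)) * heat_energy M k p f t)"

text \<open>The pseudo-Poincare inequality \<open>(PPI\<^sub>p)\<close>.\<close>

definition PPI ::
    "'a measure \<Rightarrow> (real \<Rightarrow> ('a \<Rightarrow> real) \<Rightarrow> ('a \<Rightarrow> real)) \<Rightarrow> (real \<Rightarrow> 'a \<Rightarrow> 'a \<Rightarrow> real) \<Rightarrow> real \<Rightarrow> bool"
  where "PPI M P k p \<longleftrightarrow>
    (\<exists>C>0. \<forall>t\<ge>0. \<forall>f\<in>sobolev_bv M k p.
      Lnorm M (ennreal p) (\<lambda>x. P t f x - f x)
        \<le> ennreal (C * t powr critical_exponent M k p) * Var M k p f)"

end

theory Submission
  imports Defs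
begin

text \<open>
  Fix \<open>f\<close>, let \<open>\<alpha>\<close> be the critical exponent and \<open>V = Var f\<close>, and write
  \<open>N l = \<mu> {\<bar>f\<bar> > l}\<close>. The proof turns the pseudo-Poincare inequality into a self-improving
  decay of \<open>N\<close>, which forces \<open>N\<close> to vanish beyond a finite level.

  For \<open>0 < a < b\<close> the slice \<open>g = min (max (\<bar>f\<bar> - a) 0) (b - a)\<close> is a contraction of \<open>f\<close>, so
  \<open>Var g \<le> V\<close>. It has integral at most \<open>(b - a) N a\<close>, hence the kernel bound gives
  \<open>P\<^sub>t g \<le> Ch t\<^sup>-\<^sup>\<beta> (b - a) N a\<close>. When \<open>t\<close> is chosen to make this bound \<open>(b - a) / 2\<close>,
  the functions \<open>g\<close> and \<open>P\<^sub>t g\<close> differ by at least \<open>(b - a) / 2\<close> on \<open>{\<bar>f\<bar> > b}\<close>, and the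
  pseudo-Poincare inequality for \<open>g\<close> together with Chebyshev's inequality yields, with
  \<open>\<delta> = \<alpha> / \<beta>\<close> and a constant \<open>B\<close>,
  \<open>N b \<le> (B * V * N a powr \<delta> / (b - a)) powr p\<close>. This is \<open>level_set_decay\<close>.

  The assumption \<open>p \<alpha> > \<beta>\<close> says exactly that the total power \<open>p \<delta>\<close> of \<open>N a\<close> exceeds 1.
  The iteration of De Giorgi and Stampacchia along the levels \<open>a + d (1 - 2\<^sup>-\<^sup>n)\<close>
  (\<open>Stampacchia_vanishing\<close>) then shows \<open>N (a + d) = 0\<close> as soon as
  \<open>d \<ge> K * V * N a powr (\<delta> - 1 / p)\<close>, for a constant \<open>K\<close>. Thus \<open>\<bar>f\<bar> \<le> a + d\<close> almost
  everywhere (\<open>essential_bound_from_level_set\<close>).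

  Only now does \<open>s\<close> enter: with \<open>L\<close> the \<open>L\<^sup>s\<close> norm of \<open>f\<close>, Chebyshev's inequality bounds
  \<open>N a\<close> by \<open>(L / a)\<^sup>s\<close>, and the level \<open>a\<close> with \<open>a = V (L / a)\<^sup>\<eta>\<close>, where
  \<open>\<eta> = s (\<delta> - 1 / p)\<close>, is the product of \<open>V\<close> and \<open>L\<close> to the powers \<open>\<theta> = 1 / (1 + \<eta>)\<close> and
  \<open>1 - \<theta>\<close>. This gives the inequality with constant \<open>1 + K\<close>, uniformly in \<open>s\<close>.
\<close>

section \<open>Extended powers and Lebesgue norms\<close>

lemma epowr_ennreal [simp]: "0 \<le> r \<Longrightarrow> ennreal r epowr a = ennreal (r powr a)"
  by (simp add: epowr_def)

lemma epowr_mono: "0 \<le> a \<Longrightarrow> x \<le> y \<Longrightarrow> x epowr a \<le> y epowr a"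
  by (cases x; cases y) (auto simp: epowr_def top_unique intro!: ennreal_leI powr_mono2)

lemma Lnorm_real:
  "0 \<le> q \<Longrightarrow> Lnorm M (ennreal q) h = (\<integral>\<^sup>+x. ennreal (\<bar>h x\<bar> powr q) \<partial>M) epowr (1 / q)"
  by (simp add: Lnorm_def)

lemma Lnorm_mono:
  assumes "0 \<le> q" and "\<And>x. x \<in> space M \<Longrightarrow> \<bar>g x\<bar> \<le> \<bar>f x\<bar>"
  shows "Lnorm M (ennreal q) g \<le> Lnorm M (ennreal q) f"
  unfolding Lnorm_real[OF assms(1)] using assms
  by (intro epowr_mono nn_integral_mono ennreal_leI powr_mono2) auto

text \<open>
  Chebyshev's inequality in two roles: with \<open>h = f\<close> it bounds the level sets of \<open>f\<close> by norms of
  \<open>f\<close>, and with \<open>h = P t g - g\<close> it turns the pseudo-Poincare inequality into a bound on a level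
  set. Finiteness of the measure is a separate conclusion because \<open>measure\<close> is 0 on sets of
  infinite measure.
\<close>

lemma Chebyshev_Lnorm:
  assumes A: "A \<in> sets M" and c: "0 < c" and q: "0 < q" and L: "0 \<le> L"
    and ge: "AE x in M. x \<in> A \<longrightarrow> c \<le> \<bar>h x\<bar>"
    and norm: "Lnorm M (ennreal q) h \<le> ennreal L"
  shows "emeasure M A < \<infinity>" and "measure M A \<le> (L / c) powr q"
proof -
  define I where "I = (\<integral>\<^sup>+x. ennreal (\<bar>h x\<bar> powr q) \<partial>M)"
  have I: "I epowr (1 / q) \<le> ennreal L"
    using norm q by (simp add: Lnorm_real I_def)
  then have "I \<noteq> \<infinity>" by (auto simp: epowr_def top_unique split: if_splits)
  then obtain r where r: "I = ennreal r" "0 \<le> r" by (cases I) auto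
  have "r powr (1 / q) \<le> L" using I L r by simp
  then have "(r powr (1 / q)) powr q \<le> L powr q"
    using q by (intro powr_mono2) auto
  then have rL: "r \<le> L powr q" using q r by (simp add: powr_powr)
  have "ennreal (c powr q) * emeasure M A = (\<integral>\<^sup>+x. ennreal (c powr q) * indicator A x \<partial>M)"
    using A by (simp add: nn_integral_cmult_indicator)
  also have "\<dots> \<le> I"
    unfolding I_def
  proof (rule nn_integral_mono_AE)
    show "AE x in M. ennreal (c powr q) * indicator A x \<le> ennreal (\<bar>h x\<bar> powr q)"
      using ge by eventually_elim
        (use c q in \<open>auto simp: indicator_def intro!: ennreal_leI powr_mono2\<close>)
  qed
  finally have le: "ennreal (c powr q) * emeasure M A \<le> ennreal r" using r by simp
  then show fin: "emeasure M A < \<infinity>"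
    using c by (cases "emeasure M A") (auto simp: ennreal_mult_top top_unique)
  have "c powr q * measure M A \<le> r"
    using le fin r c by (simp add: emeasure_eq_ennreal_measure ennreal_mult[symmetric])
  with rL have "c powr q * measure M A \<le> L powr q" by simp
  then show "measure M A \<le> (L / c) powr q"
    using c L by (simp add: powr_divide field_simps)
qed


section \<open>Contractions decrease the variation\<close>

lemma heat_energy_contraction:
  assumes "heat_kernel M P k" and "0 < t" and "0 \<le> p"
    and "\<And>x y. \<bar>g x - g y\<bar> \<le> \<bar>f x - f y\<bar>"
  shows "heat_energy M k p g t \<le> heat_energy M k p f t"
  unfolding heat_energy_def using assms
  by (intro epowr_mono nn_integral_mono ennreal_leI mult_left_mono powr_mono2)
    (auto simp: heat_kernel_def)

text \<open>
  The energy sees \<open>f\<close> only through the increments \<open>\<bar>f x - f y\<bar>\<close>, against a nonnegative kernel.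
  This is what lets the pseudo-Poincare inequality be applied to slices of \<open>f\<close>.
\<close>

lemma
  assumes hk: "heat_kernel M P k" and p: "0 \<le> p"
    and meas: "g \<in> borel_measurable M"
    and le: "\<And>x. \<bar>g x\<bar> \<le> \<bar>f x\<bar>"
    and contr: "\<And>x y. \<bar>g x - g y\<bar> \<le> \<bar>f x - f y\<bar>"
  shows sobolev_bv_contraction: "f \<in> sobolev_bv M k p \<Longrightarrow> g \<in> sobolev_bv M k p"
    and Var_contraction: "Var M k p g \<le> Var M k p f"
proof -
  have ev: "\<forall>\<^sub>F t in at_right 0. ennreal (t powr - critical_exponent M k p) * heat_energy M k p g t
      \<le> ennreal (t powr - critical_exponent M k p) * heat_energy M k p f t"
    using eventually_at_right_less[of "0::real"]
    by eventually_elim (intro mult_left_mono heat_energy_contraction[OF hk _ p contr], auto)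
  show "Var M k p g \<le> Var M k p f"
    unfolding Var_def by (rule Liminf_mono[OF ev])
  show "g \<in> sobolev_bv M k p" if "f \<in> sobolev_bv M k p"
    using that meas Lnorm_mono[OF p, of M g f] Limsup_mono[OF ev] le
    by (auto simp: sobolev_bv_def besov_def Lspace_def intro: le_less_trans)
qed

text \<open>The class asks for a finite upper limit of the quantity whose lower limit is \<open>Var\<close>.\<close>

lemma Var_finite: "f \<in> sobolev_bv M k p \<Longrightarrow> Var M k p f < \<infinity>"
  unfolding sobolev_bv_def besov_def Var_def
  using Liminf_le_Limsup[of "at_right (0::real)"
      "\<lambda>t. ennreal (t powr - critical_exponent M k p) * heat_energy M k p f t"]
  by (auto intro: le_less_trans)


section \<open>Decay of level sets\<close>

text \<open>
  Ultracontractivity from \<open>L\<^sup>1\<close> to \<open>L\<^sup>\<infinity>\<close>. The bound on the kernel holds only almost everywhere on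
  the product, so Fubini's theorem is needed to use it in the integral at almost every point.
\<close>

lemma heat_semigroup_le:
  assumes sf: "sigma_finite_measure M" and hk: "heat_kernel M P k" and t: "0 < t"
    and bound: "AE (x, y) in M \<Otimes>\<^sub>M M. k t x y \<le> c"
    and q: "1 \<le> q" "g \<in> Lspace M q"
    and g: "integrable M g" "\<And>x. 0 \<le> g x"
  shows "AE x in M. P t g x \<le> c * (\<integral>y. g y \<partial>M)"
proof -
  interpret pair_sigma_finite M M using sf by (intro pair_sigma_finite.intro)
  have "AE x in M. AE y in M. k t x y \<le> c"
    using AE_pair[OF bound] by simp
  moreover have "AE x in M. integrable M (\<lambda>y. k t x y * g y) \<and> P t g x = (\<integral>y. k t x y * g y \<partial>M)"
    using hk t q by (auto simp: heat_kernel_def)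
  ultimately show ?thesis
  proof eventually_elim
    case (elim x)
    have "AE y in M. k t x y * g y \<le> c * g y"
      using elim(1) by eventually_elim (use g in \<open>auto intro: mult_right_mono\<close>)
    then have "(\<integral>y. k t x y * g y \<partial>M) \<le> (\<integral>y. c * g y \<partial>M)"
      using elim g by (intro integral_mono_AE) auto
    then show ?case using elim by simp
  qed
qed

text \<open>
  The pseudo-Poincare inequality for the slice of \<open>f\<close> between the levels \<open>a\<close> and \<open>b\<close>, at the time
  after which the heat flow has spread the slice, supported where \<open>\<bar>f\<bar> > a\<close>, down to half of its
  height.
\<close>

lemma level_set_decay:
  fixes M :: "'a measure" and k :: "real \<Rightarrow> 'a \<Rightarrow> 'a \<Rightarrow> real" and f :: "'a \<Rightarrow> real"
    and p \<beta> Ch C V :: real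
  defines "N \<equiv> \<lambda>l. measure M {x\<in>space M. l < \<bar>f x\<bar>}"
    and "\<alpha> \<equiv> critical_exponent M k p"
  assumes sf: "sigma_finite_measure M" and hk: "heat_kernel M P k"
    and Ch: "0 < Ch" and \<beta>: "0 < \<beta>"
    and bound: "\<forall>t>0. AE (x, y) in M \<Otimes>\<^sub>M M. k t x y \<le> Ch * t powr (- \<beta>)"
    and p: "1 \<le> p" and C: "0 < C"
    and PPI: "\<forall>t\<ge>0. \<forall>f\<in>sobolev_bv M k p.
      Lnorm M (ennreal p) (\<lambda>x. P t f x - f x) \<le> ennreal (C * t powr \<alpha>) * Var M k p f"
    and f: "f \<in> sobolev_bv M k p"
    and V: "0 \<le> V" "Var M k p f \<le> ennreal V"
    and ab: "0 < a" "a < b"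
  shows "emeasure M {x\<in>space M. a < \<bar>f x\<bar>} < \<infinity>"
    and "N b \<le> (2 * C * (2 * Ch) powr (\<alpha> / \<beta>) * V * N a powr (\<alpha> / \<beta>) / (b - a)) powr p"
proof -
  define g where "g = (\<lambda>x. min (max (\<bar>f x\<bar> - a) 0) (b - a))"
  let ?A = "{x\<in>space M. a < \<bar>f x\<bar>}" and ?B = "{x\<in>space M. b < \<bar>f x\<bar>}"
  have fL: "f \<in> Lspace M (ennreal p)" using f by (simp add: sobolev_bv_def besov_def)
  then have meas[measurable]: "f \<in> borel_measurable M" by (simp add: Lspace_def)
  have gmeas[measurable]: "g \<in> borel_measurable M" unfolding g_def by measurable
  obtain L where L: "0 \<le> L" "Lnorm M (ennreal p) f \<le> ennreal L"
    using fL by (cases "Lnorm M (ennreal p) f") (auto simp: Lspace_def)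
  show finA: "emeasure M ?A < \<infinity>"
    by (rule Chebyshev_Lnorm(1)[OF _ ab(1) _ L(1) _ L(2)]) (use p in auto)
  have gcontr: "\<bar>g x - g y\<bar> \<le> \<bar>f x - f y\<bar>" and gle: "\<bar>g x\<bar> \<le> \<bar>f x\<bar>" for x y
    using ab unfolding g_def by linarith+
  have gS: "g \<in> sobolev_bv M k p" and gV: "Var M k p g \<le> Var M k p f"
    using p sobolev_bv_contraction[OF hk _ gmeas gle gcontr f]
      Var_contraction[OF hk _ gmeas gle gcontr] by auto
  show "N b \<le> (2 * C * (2 * Ch) powr (\<alpha> / \<beta>) * V * N a powr (\<alpha> / \<beta>) / (b - a)) powr p"
  proof (cases "N a = 0")
    case True
    then have "N b \<le> 0"
      using measure_mono_fmeasurable[of ?B ?A M] ab finA unfolding N_def fmeasurable_def by fastforce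
    then show ?thesis by (rule order_trans) simp
  next
    case False
    then have Na: "0 < N a" by (simp add: N_def order_le_neq_trans)
    \<comment> \<open>The time at which \<open>Ch * t powr (- \<beta>) * N a = 1 / 2\<close>.\<close>
    define t where "t = (2 * Ch * N a) powr (1 / \<beta>)"
    have t: "0 < t" using Ch Na by (simp add: t_def)
    have tb: "Ch * t powr (- \<beta>) = 1 / (2 * N a)"
      using Ch Na \<beta> by (simp add: t_def powr_powr powr_minus field_simps)
    have ta: "t powr \<alpha> = (2 * Ch) powr (\<alpha> / \<beta>) * N a powr (\<alpha> / \<beta>)"
      using Ch Na by (simp add: t_def powr_powr powr_mult)
    have indA: "integrable M (\<lambda>x. (b - a) * indicator ?A x :: real)"
      using finA by (intro integrable_mult_right integrable_real_indicator) auto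
    have gle_ind: "g x \<le> (b - a) * indicator ?A x" if "x \<in> space M" for x
      using that ab by (auto simp: g_def indicator_def)
    have g0: "0 \<le> g x" for x using ab by (simp add: g_def)
    have gint: "integrable M g"
      by (rule Bochner_Integration.integrable_bound[OF indA]) (use gle_ind g0 ab in auto)
    have gI: "(\<integral>x. g x \<partial>M) \<le> (b - a) * N a"
    proof -
      have "(\<integral>x. g x \<partial>M) \<le> (\<integral>x. (b - a) * indicator ?A x \<partial>M)"
        by (rule integral_mono[OF gint indA]) (use gle_ind in auto)
      also have "\<dots> = (b - a) * N a" by (simp add: N_def)
      finally show ?thesis .
    qed
    have "AE x in M. P t g x \<le> (1 / (2 * N a)) * (\<integral>y. g y \<partial>M)"
      using heat_semigroup_le[OF sf hk t bound[rule_format, OF t, unfolded tb], of "ennreal p" g]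
        p gS gint g0 by (auto simp: sobolev_bv_def besov_def)
    moreover have "(1 / (2 * N a)) * (\<integral>y. g y \<partial>M) \<le> (b - a) / 2"
      using gI Na by (simp add: field_simps)
    ultimately have "AE x in M. P t g x \<le> (b - a) / 2" by auto
    then have AEB: "AE x in M. x \<in> ?B \<longrightarrow> (b - a) / 2 \<le> \<bar>P t g x - g x\<bar>"
      by eventually_elim (use ab in \<open>auto simp: g_def\<close>)
    have "Lnorm M (ennreal p) (\<lambda>x. P t g x - g x) \<le> ennreal (C * t powr \<alpha>) * ennreal V"
      using PPI[rule_format, OF less_imp_le[OF t] gS] gV V(2) by (meson mult_left_mono order_trans zero_le)
    also have "\<dots> = ennreal (C * t powr \<alpha> * V)"
      using C V by (simp add: ennreal_mult)
    finally have "measure M ?B \<le> (C * t powr \<alpha> * V / ((b - a) / 2)) powr p"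
      using p ab C V AEB by (intro Chebyshev_Lnorm(2)) auto
    then show ?thesis by (simp add: N_def ta mult_ac) 
  qed
qed


section \<open>Iteration over levels\<close>

text \<open>
  Along the levels \<open>a + d (1 - 2\<^sup>-\<^sup>n)\<close> the gaps halve, which costs a factor \<open>2\<^sup>p\<close> per step in the
  decay hypothesis. Since that hypothesis is superlinear in \<open>\<phi>\<close> (\<open>1 < p * \<delta>\<close>), a fast enough
  geometric decay of \<open>\<phi>\<close> pays for this factor and reproduces itself. The condition on \<open>d\<close> makes
  the constants small enough for the decay to have that rate from the first step on.
\<close>

lemma Stampacchia_vanishing:
  fixes \<phi> :: "real \<Rightarrow> real"
  assumes p: "0 < p" and \<delta>: "1 < p * \<delta>" and B: "0 \<le> B" and d: "0 < d"
    and nonneg: "\<And>l. 0 \<le> \<phi> l" and anti: "\<And>l m. a \<le> l \<Longrightarrow> l \<le> m \<Longrightarrow> \<phi> m \<le> \<phi> l"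
    and decay: "\<And>l m. a \<le> l \<Longrightarrow> l < m \<Longrightarrow> \<phi> m \<le> (B * \<phi> l powr \<delta> / (m - l)) powr p"
    and large: "B * \<phi> a powr (\<delta> - 1 / p) * 2 powr (p * \<delta> / (p * \<delta> - 1)) \<le> d"
  shows "\<phi> (a + d) = 0"
proof (cases "\<phi> a = 0")
  case True
  then show ?thesis using anti[of a "a + d"] nonneg[of "a + d"] d by simp
next
  case False
  then have \<phi>a: "0 < \<phi> a" using nonneg[of a] by simp
  \<comment> \<open>The rate for which a decay by \<open>2 powr - r\<close> per step reproduces itself: \<open>r * (p * \<delta>) = p + r\<close>.\<close>
  define r where "r = p / (p * \<delta> - 1)"
  have r: "0 < r" using p \<delta> by (simp add: r_def)
  define l where "l = (\<lambda>n::nat. a + d * (1 - 2 powr - real n))"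
  have l_ge: "a \<le> l n" for n
  proof -
    have "2 powr - real n \<le> 2 powr (0::real)" by (intro powr_mono) auto
    then show ?thesis using d by (simp add: l_def)
  qed
  have step: "\<phi> (l n) \<le> \<phi> a * 2 powr (- real n * r)" for n
  proof (induction n)
    case 0
    then show ?case by (simp add: l_def)
  next
    case (Suc n)
    have "2 powr - real n = 2 * 2 powr - real (Suc n)"
      using powr_add[of 2 1 "- real (Suc n)"] by simp
    then have diff: "l (Suc n) - l n = d * 2 powr - real (Suc n)"
      by (simp add: l_def algebra_simps)
    have dpos: "0 < l (Suc n) - l n" unfolding diff using d by simp
    have Bd: "B * \<phi> a powr (\<delta> - 1 / p) / d \<le> 2 powr - (p * \<delta> / (p * \<delta> - 1))"
      using large d by (simp add: powr_minus field_simps)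
    have \<delta>0: "0 < \<delta>" using \<delta> p by (smt (verit) mult_nonneg_nonpos)
    have "B * \<phi> (l n) powr \<delta> / (l (Suc n) - l n)
        \<le> B * (\<phi> a * 2 powr (- real n * r)) powr \<delta> / (l (Suc n) - l n)"
      using Suc.IH B dpos nonneg \<delta>0
      by (intro divide_right_mono mult_left_mono powr_mono2) auto
    also have "\<dots> = (B * \<phi> a powr (\<delta> - 1 / p) / d) * \<phi> a powr (1 / p)
        * 2 powr (real (Suc n) - real n * r * \<delta>)"
    proof -
      have "\<phi> a powr \<delta> = \<phi> a powr (\<delta> - 1 / p) * \<phi> a powr (1 / p)"
        by (simp add: powr_add[symmetric])
      moreover have "2 powr (real (Suc n) - real n * r * \<delta>)
          = 2 powr (- real n * r * \<delta>) / 2 powr - real (Suc n)"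
        unfolding powr_diff[symmetric] by (intro arg_cong[where f = "(powr) 2"]) simp
      ultimately show ?thesis
        unfolding diff using \<phi>a by (simp add: powr_mult powr_powr)
    qed
    also have "\<dots> \<le> 2 powr - (p * \<delta> / (p * \<delta> - 1)) * \<phi> a powr (1 / p)
        * 2 powr (real (Suc n) - real n * r * \<delta>)"
      using Bd by (intro mult_right_mono) auto
    also have "\<dots> = \<phi> a powr (1 / p) * 2 powr (- real (Suc n) * r / p)"
    proof -
      have "- (p * \<delta> / (p * \<delta> - 1)) + (real (Suc n) - real n * r * \<delta>) = - real (Suc n) * r / p"
      proof -
        have "r * \<delta> = 1 + r / p"
          using \<delta> p by (simp add: r_def field_simps)
        moreover have "p * \<delta> / (p * \<delta> - 1) = r * \<delta>" by (simp add: r_def)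
        moreover have "real n * r * \<delta> = real n * (r * \<delta>)" by (simp add: mult.assoc)
        ultimately show ?thesis
          by (simp only:) (simp add: algebra_simps add_divide_distrib diff_divide_distrib)
      qed
      then show ?thesis by (simp add: powr_add[symmetric])
    qed
    finally have "(B * \<phi> (l n) powr \<delta> / (l (Suc n) - l n)) powr p
        \<le> (\<phi> a powr (1 / p) * 2 powr (- real (Suc n) * r / p)) powr p"
      using B dpos p by (intro powr_mono2) auto
    also have "\<dots> = \<phi> a * 2 powr (- real (Suc n) * r)"
      using p \<phi>a by (simp add: powr_mult powr_powr)
    finally show ?case using decay[OF l_ge, of n "l (Suc n)"] dpos by simp
  qed
  have "\<phi> (a + d) \<le> \<phi> a * (2 powr - r) ^ n" for n
  proof -
    have "\<phi> (a + d) \<le> \<phi> (l n)" using d by (intro anti[OF l_ge]) (simp add: l_def)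
    also have "\<dots> \<le> \<phi> a * (2 powr - r) ^ n"
      using step[of n] by (simp add: powr_power mult.commute)
    finally show ?thesis .
  qed
  moreover have "(\<lambda>n. \<phi> a * (2 powr - r) ^ n) \<longlonglongrightarrow> \<phi> a * 0"
    by (intro tendsto_mult tendsto_const LIMSEQ_power_zero) (use r in \<open>simp add: powr_less_one\<close>)
  ultimately have "\<phi> (a + d) \<le> 0"
    by (intro LIMSEQ_le_const[where X = "\<lambda>n. \<phi> a * (2 powr - r) ^ n"]) auto
  then show ?thesis using nonneg[of "a + d"] by simp
qed


section \<open>The interpolation inequality\<close>

text \<open>
  The bound is kept in terms of two free numbers \<open>a\<close> and \<open>d\<close>: no exponent \<open>s\<close> occurs, so the
  constant cannot depend on it, and letting both tend to 0 covers the case in which the optimal \<open>a\<close> would be 0.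
\<close>

lemma essential_bound_from_level_set:
  fixes M :: "'a measure" and k :: "real \<Rightarrow> 'a \<Rightarrow> 'a \<Rightarrow> real" and f :: "'a \<Rightarrow> real"
    and p \<beta> Ch C V :: real
  defines "N \<equiv> \<lambda>l. measure M {x\<in>space M. l < \<bar>f x\<bar>}"
    and "\<alpha> \<equiv> critical_exponent M k p"
  assumes sf: "sigma_finite_measure M" and hk: "heat_kernel M P k"
    and Ch: "0 < Ch" and \<beta>: "0 < \<beta>"
    and bound: "\<forall>t>0. AE (x, y) in M \<Otimes>\<^sub>M M. k t x y \<le> Ch * t powr (- \<beta>)"
    and p: "1 \<le> p" and C: "0 < C"
    and PPI: "\<forall>t\<ge>0. \<forall>f\<in>sobolev_bv M k p.
      Lnorm M (ennreal p) (\<lambda>x. P t f x - f x) \<le> ennreal (C * t powr \<alpha>) * Var M k p f"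
    and crit: "\<beta> < p * \<alpha>"
    and f: "f \<in> sobolev_bv M k p"
    and V: "0 \<le> V" "Var M k p f \<le> ennreal V"
    and a: "0 < a" and d: "0 < d"
    and large: "2 * C * (2 * Ch) powr (\<alpha> / \<beta>) * 2 powr (p * \<alpha> / (p * \<alpha> - \<beta>))
      * V * N a powr (\<alpha> / \<beta> - 1 / p) \<le> d"
  shows "Lnorm M \<infinity> f \<le> ennreal (a + d)"
proof -
  note decay = level_set_decay[OF sf hk Ch \<beta> bound p C PPI[unfolded \<alpha>_def] f V, folded N_def \<alpha>_def]
  have meas[measurable]: "f \<in> borel_measurable M"
    using f by (simp add: sobolev_bv_def besov_def Lspace_def)
  have fin: "emeasure M {x\<in>space M. l < \<bar>f x\<bar>} < \<infinity>" if "0 < l" for l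
    using decay(1)[OF that, of "l + 1"] by simp
  have exponent: "p * (\<alpha> / \<beta>) / (p * (\<alpha> / \<beta>) - 1) = p * \<alpha> / (p * \<alpha> - \<beta>)"
    using crit \<beta> by (simp add: field_simps)
  have "N (a + d) = 0"
  proof (rule Stampacchia_vanishing[where p = p and \<delta> = "\<alpha> / \<beta>" and d = d and \<phi> = N
        and B = "2 * C * (2 * Ch) powr (\<alpha> / \<beta>) * V"])
    show "N m \<le> N l" if "a \<le> l" "l \<le> m" for l m
      unfolding N_def measure_def
      by (intro enn2real_mono emeasure_mono) (use that a fin[of l] in auto)
    show "N m \<le> (2 * C * (2 * Ch) powr (\<alpha> / \<beta>) * V * N l powr (\<alpha> / \<beta>) / (m - l)) powr p"
      if "a \<le> l" "l < m" for l m
      using decay(2)[of l m] that a by (simp add: N_def)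
    show "2 * C * (2 * Ch) powr (\<alpha> / \<beta>) * V * N a powr (\<alpha> / \<beta> - 1 / p)
        * 2 powr (p * (\<alpha> / \<beta>) / (p * (\<alpha> / \<beta>) - 1)) \<le> d"
      using large unfolding exponent by (simp add: mult_ac)
  qed (use p C V d crit \<beta> in \<open>auto simp: N_def field_simps\<close>)
  then have "emeasure M {x\<in>space M. a + d < \<bar>f x\<bar>} = 0"
    using fin[of "a + d"] a d by (simp add: N_def emeasure_eq_ennreal_measure)
  then have "AE x in M. \<not> a + d < \<bar>f x\<bar>"
    by (subst AE_iff_measurable[OF _ refl]) auto
  then have "AE x in M. ennreal \<bar>f x\<bar> \<le> ennreal (a + d)"
    by eventually_elim (auto intro!: ennreal_leI)
  then show ?thesis by (simp add: Lnorm_def esssup_I)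
qed

theorem corollary4p4:
  fixes M :: "'a measure"
    and E :: "('a \<Rightarrow> real) \<Rightarrow> ('a \<Rightarrow> real) \<Rightarrow> real"
    and F :: "('a \<Rightarrow> real) set"
    and P :: "real \<Rightarrow> ('a \<Rightarrow> real) \<Rightarrow> ('a \<Rightarrow> real)"
    and k :: "real \<Rightarrow> 'a \<Rightarrow> 'a \<Rightarrow> real"
    and p \<beta> Ch :: real
  assumes "sigma_finite_measure M"
    and "dirichlet_form M E F"
    and "heat_semigroup M E F P"
    and "conservative M P"
    and "heat_kernel M P k"
    and "0 < Ch" and "0 < \<beta>"
    and "\<And>t. 0 < t \<Longrightarrow> AE (x, y) in M \<Otimes>\<^sub>M M. k t x y \<le> Ch * t powr (- \<beta>)"
    and "1 \<le> p"
    and "nonconstant_exponents M k p \<noteq> {}" and "bdd_above (nonconstant_exponents M k p)"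
    and "PPI M P k p"
    and "p * critical_exponent M k p > \<beta>"
  shows "\<exists>Cp>0. \<forall>f\<in>sobolev_bv M k p. \<forall>s\<ge>1.
    (let \<theta> = p * \<beta> / (p * \<beta> + s * (p * critical_exponent M k p - \<beta>)) in
      0 < \<theta> \<and> \<theta> < 1 \<and>
      Lnorm M \<infinity> f
        \<le> ennreal Cp * Var M k p f epowr \<theta> * Lnorm M (ennreal s) f epowr (1 - \<theta>))"
  proof -
  define \<alpha> where "\<alpha> = critical_exponent M k p"
  obtain C where C: "0 < C" and PPI: "\<forall>t\<ge>0. \<forall>f\<in>sobolev_bv M k p.
      Lnorm M (ennreal p) (\<lambda>x. P t f x - f x)
        \<le> ennreal (C * t powr critical_exponent M k p) * Var M k p f"
    using \<open>PPI M P k p\<close> unfolding PPI_def by blast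
  have p: "1 \<le> p" and \<beta>: "0 < \<beta>" and crit: "\<beta> < p * \<alpha>" using assms by (auto simp: \<alpha>_def)
  define K where "K = 2 * C * (2 * Ch) powr (\<alpha> / \<beta>) * 2 powr (p * \<alpha> / (p * \<alpha> - \<beta>))"
  have K: "0 < K" using C \<open>0 < Ch\<close> by (simp add: K_def)
  have kbound: "\<forall>t>0. AE (x, y) in M \<Otimes>\<^sub>M M. k t x y \<le> Ch * t powr (- \<beta>)"
    using assms(8) by blast
  note bound = essential_bound_from_level_set[OF assms(1,5,6,7) kbound assms(9) C PPI assms(13),
      folded \<alpha>_def, folded K_def]
  have main: "Lnorm M \<infinity> f
      \<le> ennreal (1 + K) * Var M k p f epowr \<theta> * Lnorm M (ennreal s) f epowr (1 - \<theta>)"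
    if f: "f \<in> sobolev_bv M k p" and s: "1 \<le> s"
      and \<theta>: "0 < \<theta>" "\<theta> < 1" and \<theta>_def: "\<theta> = p * \<beta> / (p * \<beta> + s * (p * \<alpha> - \<beta>))" for f s \<theta>
  proof -
    have meas[measurable]: "f \<in> borel_measurable M"
      using f by (simp add: sobolev_bv_def besov_def Lspace_def)
    obtain V where V: "0 \<le> V" "Var M k p f = ennreal V"
      using Var_finite[OF f] by (cases "Var M k p f") auto
    note bound_f = bound[OF f V(1) eq_refl[OF V(2)]]
    define N where "N l = measure M {x\<in>space M. l < \<bar>f x\<bar>}" for l
    \<comment> \<open>If \<open>V\<close> or \<open>L\<close> vanishes, the optimal level would be 0; instead every positive level is admissible
      with every positive \<open>d\<close>. In particular \<open>V = 0\<close> forces \<open>f = 0\<close>, as it must because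
      \<open>0 * \<infinity> = 0\<close> on the right-hand side when the \<open>L\<^sup>s\<close> norm is infinite.\<close>
    have zero: "Lnorm M \<infinity> f = 0" if null: "\<And>a. 0 < a \<Longrightarrow> V * N a powr (\<alpha> / \<beta> - 1 / p) = 0"
    proof -
      have "Lnorm M \<infinity> f \<le> 0 + ennreal e" if e: "0 < e" for e
      proof -
        have "K * V * N (e / 2) powr (\<alpha> / \<beta> - 1 / p) \<le> e / 2"
          using null[of "e / 2"] e by auto
        then show ?thesis using bound_f[of "e / 2" "e / 2", folded N_def] e by simp
      qed
      then have "Lnorm M \<infinity> f \<le> 0" by (rule ennreal_le_epsilon)
      then show ?thesis by simp
    qed
    show ?thesis
    proof (cases "V = 0")
      case True
      then show ?thesis using zero by simp
    next
      case False
      with V have Vpos: "0 < V" by simp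
      show ?thesis
      proof (cases "Lnorm M (ennreal s) f")
        case top
        then show ?thesis using K Vpos V by (simp add: epowr_def ennreal_mult_top)
      next
        case (real L)
        have cheb: "N a \<le> (L / a) powr s" if "0 < a" for a
          unfolding N_def
          by (rule Chebyshev_Lnorm(2)[of _ M a s L f]) (use that s real in auto)
        show ?thesis
        proof (cases "L = 0")
          case True
          then have "N a = 0" if "0 < a" for a
            using cheb[OF that] by (simp add: N_def measure_le_0_iff)
          then show ?thesis using zero by simp
        next
          case False
          with real have L: "0 < L" by simp
          define \<eta> where "\<eta> = s * (\<alpha> / \<beta> - 1 / p)"
          have \<eta>\<theta>: "\<eta> * \<theta> = 1 - \<theta>"
          proof -
            have "0 < p * \<beta> + s * (p * \<alpha> - \<beta>)"
              using p \<beta> crit s by (intro add_pos_pos mult_pos_pos) auto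
            then have "1 - \<theta> = s * (p * \<alpha> - \<beta>) / (p * \<beta> + s * (p * \<alpha> - \<beta>))"
              unfolding \<theta>_def by (simp add: diff_divide_eq_iff)
            moreover have "\<eta> * (p * \<beta>) = s * (p * \<alpha> - \<beta>)"
              using p \<beta> unfolding \<eta>_def by (simp add: field_simps)
            ultimately show ?thesis by (simp add: \<theta>_def)
          qed
          \<comment> \<open>The level that solves \<open>a = V * (L / a) powr \<eta>\<close>.\<close>
          define a where "a = V powr \<theta> * L powr (1 - \<theta>)"
          have a: "0 < a" using Vpos L by (simp add: a_def)
          have "N a powr (\<alpha> / \<beta> - 1 / p) \<le> ((L / a) powr s) powr (\<alpha> / \<beta> - 1 / p)"
            using cheb[OF a] crit p \<beta> by (intro powr_mono2) (auto simp: N_def field_simps)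
          also have "\<dots> = (L / a) powr \<eta>" by (simp add: powr_powr \<eta>_def)
          also have "L / a = (L / V) powr \<theta>"
            using Vpos L by (simp add: a_def powr_divide powr_diff field_simps)
          also have "\<dots> powr \<eta> = (L / V) powr (1 - \<theta>)"
            by (simp add: powr_powr \<eta>\<theta> mult.commute)
          finally have "V * N a powr (\<alpha> / \<beta> - 1 / p) \<le> V * (L / V) powr (1 - \<theta>)"
            using Vpos by simp
          also have "\<dots> = a"
            using Vpos L by (simp add: a_def powr_divide powr_diff field_simps)
          finally have "K * V * N a powr (\<alpha> / \<beta> - 1 / p) \<le> K * a"
            using K by (simp add: mult.assoc)
          then have "Lnorm M \<infinity> f \<le> ennreal (a + K * a)"
            using bound_f[of a "K * a"] a K by (simp add: N_def)
          also have "\<dots> = ennreal (1 + K) * Var M k p f epowr \<theta> * Lnorm M (ennreal s) f epowr (1 - \<theta>)"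
            using K V real by (simp add: a_def ennreal_mult[symmetric] algebra_simps)
          finally show ?thesis .
        qed
      qed
    qed
  qed
  show ?thesis
  proof (intro exI[of _ "1 + K"] conjI ballI allI impI)
    show "0 < 1 + K" using K by simp
    fix f and s :: real assume f: "f \<in> sobolev_bv M k p" and s: "1 \<le> s"
    have "0 < p * \<beta>" "0 < s * (p * \<alpha> - \<beta>)" using p \<beta> s crit by auto
    then have "0 < p * \<beta> / (p * \<beta> + s * (p * \<alpha> - \<beta>))" "p * \<beta> / (p * \<beta> + s * (p * \<alpha> - \<beta>)) < 1"
      by (auto simp: field_simps)
    with main[OF f s _ _ refl] show "let \<theta> = p * \<beta> / (p * \<beta> + s * (p * critical_exponent M k p - \<beta>)) in
      0 < \<theta> \<and> \<theta> < 1 \<and>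
      Lnorm M \<infinity> f
        \<le> ennreal (1 + K) * Var M k p f epowr \<theta> * Lnorm M (ennreal s) f epowr (1 - \<theta>)"
      by (simp add: Let_def \<alpha>_def[symmetric])
  qed
qed

end
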